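(* Let $J$ be the subgraph of $K_{3,3}$ with edge set $\{(1,1'),(2,3'),(3,2')\}$. Then $\chi_\infty(K_3,J)=4$.
   Context: Let $G=K_3$ with vertex set $\{v_1,v_2,v_3\}$. $K_{3,3}$ is the complete bipartite graph with parts $\{1,2,3\}$ and $\{1',2',3'\}$. The self-similar graphs based on $(G,J)$: $G^1=G$; for $k\ge2$, $V(G^k)=V(G)^k$, and $(v_{i_1},\dots,v_{i_k})\sim(v_{j_1},\dots,v_{j_k})$ in $G^k$ iff either (1) $(v_{i_1},\dots,v_{i_{k-1}})=(v_{j_1},\dots,v_{j_{k-1}})$ and $v_{i_k}\sim v_{j_k}$ in $G$, or (2) $(v_{i_1},\dots,v_{i_{k-1}})\sim(v_{j_1},\dots,v_{j_{k-1}})$ in $G^{k-1}$ and $i_k\sim j_k'$ in $J$. The sequence $\chi(G^k)$ is non-decreasing; $\chi_\infty(G,J)$ denotes its limit, with $\chi_\infty(G,J)=\infty$ if it is unbounded. *)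

theory Defs
  imports "Graph_Theory.Graph_Theory" "HOL-Library.Extended_Real"
begin

section \<open>Chromatic number\<close>

definition proper_colouring :: "('a, 'b) pre_digraph \<Rightarrow> nat \<Rightarrow> ('a \<Rightarrow> nat) \<Rightarrow> bool" where
  "proper_colouring G n c \<longleftrightarrow>
     (\<forall>v \<in> verts G. c v < n) \<and> (\<forall>u v. u \<rightarrow>\<^bsub>G\<^esub> v \<longrightarrow> c u \<noteq> c v)"

text \<open>Meaningful for finite loop-free graphs, where some proper colouring exists.\<close>

definition chromatic_number :: "('a, 'b) pre_digraph \<Rightarrow> nat" where
  "chromatic_number G = (LEAST n. \<exists>c. proper_colouring G n c)"

section \<open>Self-similar graphs\<close>

text \<open>
  Undirected graphs are symmetric digraphs without loops or parallel arcs (\<open>pair_graph\<close>).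
  The vertex \<open>v\<^sub>i\<close> of \<open>G\<close> is identified with its index \<open>i\<close>; in the bipartite graph \<open>J\<close>,
  \<open>Inl i\<close> stands for \<open>i\<close> and \<open>Inr j\<close> for \<open>j'\<close>. A \<open>k\<close>-tuple is a list of length \<open>k\<close>.
  The construction starts at \<open>k = 1\<close>; index \<open>0\<close> is a placeholder.
\<close>

fun self_similar_graph ::
  "'a pair_pre_digraph \<Rightarrow> ('a + 'a) pair_pre_digraph \<Rightarrow> nat \<Rightarrow> 'a list pair_pre_digraph" where
  "self_similar_graph G J 0 = \<lparr> pverts = {}, parcs = {} \<rparr>"
| "self_similar_graph G J (Suc 0) =
     \<lparr> pverts = {[v] | v. v \<in> pverts G}, parcs = {([u], [v]) | u v. (u, v) \<in> parcs G} \<rparr>"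
| "self_similar_graph G J (Suc (Suc k)) =
     \<lparr> pverts = {xs. length xs = Suc (Suc k) \<and> set xs \<subseteq> pverts G},
       parcs = {(xs @ [u], ys @ [v]) | xs u ys v.
         xs \<in> pverts (self_similar_graph G J (Suc k)) \<and> u \<in> pverts G \<and>
         ys \<in> pverts (self_similar_graph G J (Suc k)) \<and> v \<in> pverts G \<and>
         (xs = ys \<and> (u, v) \<in> parcs G \<or>
          (xs, ys) \<in> parcs (self_similar_graph G J (Suc k)) \<and> (Inl u, Inr v) \<in> parcs J)} \<rparr>"

text \<open>
  The limit is taken in \<open>enat\<close>, so it is \<open>\<infinity>\<close> if the non-decreasing sequence is unbounded.
\<close>

definition chi_infty :: "'a pair_pre_digraph \<Rightarrow> ('a + 'a) pair_pre_digraph \<Rightarrow> enat" where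
  "chi_infty G J = lim (\<lambda>k. enat (chromatic_number (self_similar_graph G J k)))"

lemma chi_infty_eq_SUP:
  assumes "incseq (\<lambda>k. enat (chromatic_number (self_similar_graph G J k)))"
  shows "chi_infty G J = (SUP k. enat (chromatic_number (self_similar_graph G J k)))"
  unfolding chi_infty_def by (rule limI[OF LIMSEQ_SUP[OF assms]])

section \<open>The concrete graphs\<close>

definition K3 :: "nat pair_pre_digraph" where
  "K3 = \<lparr> pverts = {1, 2, 3}, parcs = {(u, v). u \<in> {1, 2, 3} \<and> v \<in> {1, 2, 3} \<and> u \<noteq> v} \<rparr>"

definition K33 :: "(nat + nat) pair_pre_digraph" where
  "K33 = \<lparr> pverts = Inl ` {1, 2, 3} \<union> Inr ` {1, 2, 3},
           parcs = Inl ` {1, 2, 3} \<times> Inr ` {1, 2, 3} \<union> Inr ` {1, 2, 3} \<times> Inl ` {1, 2, 3} \<rparr>"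

text \<open>The spanning subgraph of \<^const>\<open>K33\<close> with a given edge set; a pair \<open>(i, j)\<close> is the edge \<open>(i, j')\<close>.\<close>

definition subgraph_of_K33 :: "(nat \<times> nat) set \<Rightarrow> (nat + nat) pair_pre_digraph" where
  "subgraph_of_K33 E =
     \<lparr> pverts = pverts K33,
       parcs = {(Inl i, Inr j) | i j. (i, j) \<in> E} \<union> {(Inr j, Inl i) | i j. (i, j) \<in> E} \<rparr>"

lemma K3_complete: "K\<^bsub>3\<^esub> (with_proj K3)"
  unfolding complete_digraph_pair_def K3_def pair_pre_digraph.simps mem_Sigma_iff conj_assoc
  by simp

lemma K33_complete_bipartite: "K\<^bsub>3,3\<^esub> (with_proj K33)"
  unfolding complete_bipartite_digraph_pair_def
proof (intro conjI exI)
  show "pverts K33 = Inl ` {1, 2, 3} \<union> Inr ` {1, 2, 3}"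
    by (simp add: K33_def)
  show "parcs K33 = Inl ` {1, 2, 3} \<times> Inr ` {1, 2, 3} \<union> Inr ` {1, 2, 3} \<times> Inl ` {1, 2, 3}"
    by (simp add: K33_def)
qed (auto simp: K33_def)

lemma subgraph_of_K33:
  assumes "E \<subseteq> {1, 2, 3} \<times> {1, 2, 3}"
  shows "subgraph (with_proj (subgraph_of_K33 E)) (with_proj K33)"
    and "pair_graph (subgraph_of_K33 E)"
proof -
  interpret K: pair_graph K33
    using K33_complete_bipartite by (rule pair_graphI_complete_bipartite)
  have verts: "pverts (subgraph_of_K33 E) = pverts K33"
    by (simp add: subgraph_of_K33_def)
  have sub: "parcs (subgraph_of_K33 E) \<subseteq> parcs K33"
    using assms unfolding subgraph_of_K33_def K33_def pair_pre_digraph.simps by blast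
  have wf: "wf_digraph (with_proj (subgraph_of_K33 E))"
    using K.wellformed subsetD[OF sub] by unfold_locales (simp_all only: with_proj_simps verts)
  show "subgraph (with_proj (subgraph_of_K33 E)) (with_proj K33)"
    using sub wf K.wf_digraph by (simp add: subgraph_def verts compatible_def)
  show "pair_graph (subgraph_of_K33 E)"
  proof unfold_locales
    show "symmetric (with_proj (subgraph_of_K33 E))"
      unfolding symmetric_def by (rule symI) (auto simp: subgraph_of_K33_def)
    show "finite (parcs (subgraph_of_K33 E))"
      using sub K.finite_arcs by (rule finite_subset)
  qed (use K.wellformed K.no_loops K.finite_verts subsetD[OF sub] in \<open>simp_all add: verts\<close>)
qed

text \<open>
  The adjacency rule of \<^const>\<open>self_similar_graph\<close> is symmetric when \<open>J\<close> is invariant under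
  exchanging \<open>i\<close> with \<open>i'\<close>.
\<close>

lemma pair_graph_self_similar_graph:
  assumes G: "pair_graph G"
    and swap: "\<And>u v. (Inl u, Inr v) \<in> parcs J \<Longrightarrow> (Inl v, Inr u) \<in> parcs J"
  shows "pair_graph (self_similar_graph G J k)"
proof -
  interpret G: pair_graph G by (rule G)
  have symG: "(u, v) \<in> parcs G \<Longrightarrow> (v, u) \<in> parcs G" for u v
    using G.sym_arcs by (auto simp: symmetric_def sym_def)
  have loopG: "(u, u) \<notin> parcs G" for u
    using G.no_loops[of "(u, u)"] by auto
  have wfG: "(u, v) \<in> parcs G \<Longrightarrow> u \<in> pverts G \<and> v \<in> pverts G" for u v
    using G.wellformed[of "(u, v)"] by auto
  have verts: "pverts (self_similar_graph G J k) \<subseteq> {xs. set xs \<subseteq> pverts G \<and> length xs = k}" for k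
    by (induction G J k rule: self_similar_graph.induct) auto
  have fin: "finite (pverts (self_similar_graph G J k))" for k
    by (rule finite_subset[OF verts finite_lists_length_eq])
      (use G.finite_verts in simp)
  have arcs: "(xs, ys) \<in> parcs (self_similar_graph G J k) \<Longrightarrow>
      xs \<in> pverts (self_similar_graph G J k) \<and> ys \<in> pverts (self_similar_graph G J k) \<and>
      xs \<noteq> ys \<and> (ys, xs) \<in> parcs (self_similar_graph G J k)" for xs ys k
  proof (induction k arbitrary: xs ys rule: induct_nat_012)
    case 0
    then show ?case by simp
  next
    case 1
    then show ?case by (auto simp: loopG dest: symG wfG)
  next
    case (ge2 k)
    then obtain as u bs v where *: "xs = as @ [u]" "ys = bs @ [v]"
      "as \<in> pverts (self_similar_graph G J (Suc k))" "u \<in> pverts G"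
      "bs \<in> pverts (self_similar_graph G J (Suc k))" "v \<in> pverts G"
      "as = bs \<and> (u, v) \<in> parcs G \<or>
       (as, bs) \<in> parcs (self_similar_graph G J (Suc k)) \<and> (Inl u, Inr v) \<in> parcs J"
      by auto
    have "as = bs \<and> (v, u) \<in> parcs G \<or>
       (bs, as) \<in> parcs (self_similar_graph G J (Suc k)) \<and> (Inl v, Inr u) \<in> parcs J"
      using *(7) ge2.IH(2) symG swap by blast
    moreover have "xs \<noteq> ys"
      using * ge2.IH(2) loopG by auto
    ultimately show ?case
      using * subsetD[OF verts *(3)] subsetD[OF verts *(5)] by auto
  qed
  have "finite (parcs (self_similar_graph G J k))"
    by (rule finite_subset[OF _ finite_cartesian_product[OF fin[of k] fin[of k]]])
      (use arcs in auto)
  then show ?thesis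
    unfolding pair_graph_def pair_digraph_def pair_pseudo_graph_def pair_fin_digraph_def
      pair_loopfree_digraph_def pair_sym_digraph_def pair_wf_digraph_def
      pair_fin_digraph_axioms_def pair_loopfree_digraph_axioms_def pair_sym_digraph_axioms_def
    using fin[of k] arcs[of _ _ k] by (simp add: symmetric_def sym_def split_paired_all)
qed

end

theory Submission
  imports Defs
begin

text \<open>
  An arc of \<open>G\<^sup>k\<close> joins two words with a common prefix, followed by adjacent letters, followed by
  suffixes that correspond letterwise under \<open>J\<close>. A map \<open>\<delta>\<close> that updates a colour letter by
  letter therefore gives a proper colouring of every \<open>G\<^sup>k\<close> as soon as it separates adjacent letters
  read from the same colour and \<open>J\<close>-related letters read from different colours; for the given
  \<open>J\<close> such a map exists with four colours. Conversely, in a 3-colouring of \<open>G\<^sup>2\<close> each of the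
  triangles \<open>{i} \<times> {1, 2, 3}\<close> is coloured by a permutation, and the arcs between two triangles force
  these permutations to have opposite signs, which is impossible for three triangles.
\<close>

lemma proper_colouring_mono:
  assumes "proper_colouring G m c" "m \<le> n"
  shows "proper_colouring G n c"
  using assms by (auto simp: proper_colouring_def)

lemma chromatic_number_eqI:
  assumes "proper_colouring G (Suc n) c" "\<And>c. \<not> proper_colouring G n c"
  shows "chromatic_number G = Suc n"
  unfolding chromatic_number_def
proof (rule Least_equality)
  show "\<exists>c. proper_colouring G (Suc n) c"
    using assms(1) by blast
  show "Suc n \<le> m" if "\<exists>c. proper_colouring G m c" for m
    using that assms(2) proper_colouring_mono[of G m _ n] by (meson not_less_eq_eq)
qed

lemma proper_colouring_foldl:
  fixes \<delta> :: "nat \<Rightarrow> 'a \<Rightarrow> nat"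
  assumes range: "\<And>p u. p < n \<Longrightarrow> u \<in> pverts G \<Longrightarrow> \<delta> p u < n"
    and G: "\<And>p u v. p < n \<Longrightarrow> (u, v) \<in> parcs G \<Longrightarrow> \<delta> p u \<noteq> \<delta> p v"
    and J: "\<And>p q u v. p < n \<Longrightarrow> q < n \<Longrightarrow> p \<noteq> q \<Longrightarrow> (Inl u, Inr v) \<in> parcs J \<Longrightarrow> \<delta> p u \<noteq> \<delta> q v"
    and "p < n"
  shows "proper_colouring (self_similar_graph G J k) n (foldl \<delta> p)"
proof -
  have word: "foldl \<delta> p xs < n" if "set xs \<subseteq> pverts G" for xs
    using that by (induction xs rule: rev_induct) (auto simp: \<open>p < n\<close> range)
  have verts: "foldl \<delta> p xs < n" if "xs \<in> pverts (self_similar_graph G J k)" for xs k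
    using that by (cases "(G, J, k)" rule: self_similar_graph.cases) (auto intro: word range \<open>p < n\<close>)
  have "foldl \<delta> p xs \<noteq> foldl \<delta> p ys" if "(xs, ys) \<in> parcs (self_similar_graph G J k)" for xs ys
    using that
  proof (induction k arbitrary: xs ys rule: induct_nat_012)
    case 0
    then show ?case by simp
  next
    case 1
    then show ?case using G[OF \<open>p < n\<close>] by auto
  next
    case (ge2 k)
    then obtain as u bs v where *: "xs = as @ [u]" "ys = bs @ [v]"
      "as \<in> pverts (self_similar_graph G J (Suc k))"
      "bs \<in> pverts (self_similar_graph G J (Suc k))"
      "as = bs \<and> (u, v) \<in> parcs G \<or>
       (as, bs) \<in> parcs (self_similar_graph G J (Suc k)) \<and> (Inl u, Inr v) \<in> parcs J"
      by auto
    \<comment> \<open>For an arc of the second kind the induction hypothesis supplies the distinct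
      prefix colours that \<open>J\<close> asks for.\<close>
    show ?case
      using *(5) ge2.IH(2) G[OF verts[OF *(3)]] J[OF verts[OF *(3)] verts[OF *(4)]]
      unfolding *(1,2) by auto
  qed
  then show ?thesis
    using verts by (auto simp: proper_colouring_def)
qed

text \<open>As \<open>J\<close> joins \<open>w\<close> to its own copy, appending \<open>w\<close>
  to every word embeds each level in the next, and colourings pull back.\<close>

lemma proper_colouring_self_similar_graph_Suc:
  assumes "pair_graph (self_similar_graph G J (Suc k))"
    and "(Inl w, Inr w) \<in> parcs J" "w \<in> pverts G"
    and "proper_colouring (self_similar_graph G J (Suc (Suc k))) n c"
  shows "proper_colouring (self_similar_graph G J (Suc k)) n (\<lambda>xs. c (xs @ [w]))"
proof -
  interpret pair_graph "self_similar_graph G J (Suc k)" by fact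
  have "xs @ [w] \<in> pverts (self_similar_graph G J (Suc (Suc k)))"
    if "xs \<in> pverts (self_similar_graph G J (Suc k))" for xs
    using that \<open>w \<in> pverts G\<close> by (cases k) auto
  moreover have "(xs @ [w], ys @ [w]) \<in> parcs (self_similar_graph G J (Suc (Suc k)))"
    if "(xs, ys) \<in> parcs (self_similar_graph G J (Suc k))" for xs ys
    using that assms(2,3) wellformed[OF that] by simp
  ultimately show ?thesis
    using assms(4) by (simp add: proper_colouring_def)
qed

abbreviation J1 :: "(nat + nat) pair_pre_digraph" where
  "J1 \<equiv> subgraph_of_K33 {(1, 1), (2, 3), (3, 2)}"

lemma pair_graph_K3_J1: "pair_graph (self_similar_graph K3 J1 k)"
proof (rule pair_graph_self_similar_graph)
  show "pair_graph K3"
    using K3_complete by (rule pair_graphI_complete)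
qed (auto simp: subgraph_of_K33_def)

lemma four_colouring: "\<exists>c. proper_colouring (self_similar_graph K3 J1 k) 4 c"
proof
  \<comment> \<open>Letters 2 and 3 use the disjoint palettes {0, 1} and {2, 3}, so
    \<open>J1\<close>-arcs between them never conflict. Letter 1 keeps \<open>p\<close>, and each
    palette has two colours in order to avoid \<open>p\<close>.\<close>
  let ?\<delta> = "\<lambda>p u::nat. if u = 1 then p else if u = 2 then (if p = 0 then 1 else 0)
    else (if p = 2 then 3 else (2::nat))"
  show "proper_colouring (self_similar_graph K3 J1 k) 4 (foldl ?\<delta> 0)"
    by (rule proper_colouring_foldl) (auto simp: K3_def subgraph_of_K33_def split: if_splits)
qed

text \<open>
  For a permutation \<open>(a, b, c)\<close> of the colours 0, 1, 2, the predicate \<^term>\<open>b = (a + 1) mod 3\<close>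
  says that it is even.
\<close>

lemma opposite_orientation:
  fixes a b c a' b' c' :: nat
  assumes "{a, b, c, a', b', c'} \<subseteq> {0, 1, 2}"
    and "a \<noteq> b" "a \<noteq> c" "b \<noteq> c" "a' \<noteq> b'" "a' \<noteq> c'" "b' \<noteq> c'"
    and "a \<noteq> a'" "b \<noteq> c'" "c \<noteq> b'"
  shows "(b = (a + 1) mod 3) \<noteq> (b' = (a' + 1) mod 3)"
proof -
  have perm: "(x, y, z) \<in> {(0, 1, 2), (1, 2, 0), (2, 0, 1), (0, 2, 1), (2, 1, 0), (1, 0, 2)}"
    if "x \<in> {0, 1, 2}" "y \<in> {0, 1, 2}" "z \<in> {0, 1, 2}" "x \<noteq> y" "x \<noteq> z" "y \<noteq> z" for x y z :: nat
    using that by (elim insertE emptyE) simp_all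
  have "(a, b, c) \<in> {(0, 1, 2), (1, 2, 0), (2, 0, 1), (0, 2, 1), (2, 1, 0), (1, 0, 2)}"
    using assms by (intro perm) simp_all
  moreover have "(a', b', c') \<in> {(0, 1, 2), (1, 2, 0), (2, 0, 1), (0, 2, 1), (2, 1, 0), (1, 0, 2)}"
    using assms by (intro perm) simp_all
  \<comment> \<open>The cases reflect that \<open>(a', c', b')\<close> differs from
    \<open>(a, b, c)\<close> in every position, hence is a cyclic shift of the same sign; exchanging
    \<open>b'\<close> and \<open>c'\<close> flips that sign.\<close>
  ultimately show ?thesis
    using assms(8-10) by (elim insertE emptyE) (simp_all del: insert_iff)
qed

lemma no_three_colouring_2: "\<not> proper_colouring (self_similar_graph K3 J1 2) 3 c"
proof
  assume c: "proper_colouring (self_similar_graph K3 J1 2) 3 c"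
  have range: "c [i, j] \<in> {0, 1, 2}" if "i \<in> {1, 2, 3}" "j \<in> {1, 2, 3}" for i j
  proof -
    have "c [i, j] < 3"
      using c that by (auto simp: proper_colouring_def K3_def numeral_2_eq_2)
    then show ?thesis by auto
  qed
  have arc: "c [i, u] \<noteq> c [j, v]"
    if "i \<in> {1, 2, 3}" "j \<in> {1, 2, 3}" "u \<in> {1, 2, 3}" "v \<in> {1, 2, 3}"
      "i = j \<and> u \<noteq> v \<or> i \<noteq> j \<and> (u, v) \<in> {(1, 1), (2, 3), (3, 2)}" for i j u v
  proof -
    have "([i] @ [u], [j] @ [v]) \<in> parcs (self_similar_graph K3 J1 (Suc (Suc 0)))"
      unfolding self_similar_graph.simps using that
      by (simp add: K3_def subgraph_of_K33_def del: append.simps)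
    then show ?thesis
      using c by (simp add: proper_colouring_def numeral_2_eq_2)
  qed
  define even where "even i \<longleftrightarrow> c [i, 2] = (c [i, 1] + 1) mod 3" for i
  have "even i \<noteq> even j" if "i \<in> {1, 2, 3}" "j \<in> {1, 2, 3}" "i \<noteq> j" for i j
    unfolding even_def
  proof (rule opposite_orientation)
    show "{c [i, 1], c [i, 2], c [i, 3], c [j, 1], c [j, 2], c [j, 3]} \<subseteq> {0, 1, 2}"
      by (intro insert_subsetI empty_subsetI range that) simp_all
  qed (rule arc; use that in simp)+
  from this[of 1 2] this[of 1 3] this[of 2 3] show False
    by auto
qed

lemma no_three_colouring: "\<not> proper_colouring (self_similar_graph K3 J1 (k + 2)) 3 c"
proof (induction k arbitrary: c)
  case 0
  show ?case unfolding add_0 by (rule no_three_colouring_2)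
next
  case (Suc k)
  then show ?case
    \<comment> \<open>The edge (1, 1') of \<open>J1\<close> allows \<open>w = 1\<close>.\<close>
    using proper_colouring_self_similar_graph_Suc[OF pair_graph_K3_J1, where w = 1 and k = "Suc k"]
    by (auto simp: K3_def subgraph_of_K33_def)
qed

theorem theorem4p1:
  shows "chi_infty K3 (subgraph_of_K33 {(1, 1), (2, 3), (3, 2)}) = 4"
proof -
  \<comment> \<open>The offset skips the placeholder at 0 and the 3-colourable triangle at
    1.\<close>
  have "chromatic_number (self_similar_graph K3 J1 (k + 2)) = 4" for k
    using chromatic_number_eqI[of _ 3] four_colouring[of "k + 2"] no_three_colouring[of k] by auto
  then have "(\<lambda>k. enat (chromatic_number (self_similar_graph K3 J1 (k + 2)))) \<longlonglongrightarrow> 4"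
    by (simp add: numeral_eq_enat)
  then show ?thesis
    unfolding chi_infty_def by (intro limI) (rule LIMSEQ_offset)
qed

end
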